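(* Assume the following hypothesis (H): for every $c>0$ there are $\delta_c>0$ and $c'>0$ with $\delta_c\to0$ and $c'\to0$ as $c\to0$, such that for every $N$ and all $A,A'\subseteq\mathbb{Z}_N$ with $|A|,|A'|\ge N^{1-c}$ there exists a Bohr set $B\subseteq A-A+A'-A'$ of dimension at most $\delta_c\log N$ with $|B|\gg N^{1-c'}$, such that every $b\in B$ has $\gg|A|^2|A'|^2/N$ representations in the form $b=a-a_0+a'-a'_0$ with $a,a_0\in A$, $a',a'_0\in A'$. Then for every invariant equation $a_1x_1+\dots+a_kx_k=0$ with nonzero integer coefficients satisfying $a_1=-a_2$ and $a_3=-a_4$, we have $R(N)\ll N^{1-c}$ for some $c=c(a_1,\dots,a_k)>0$.
   Context: An equation $a_1x_1+\dots+a_kx_k=0$ with integer coefficients is invariant if $a_1+\dots+a_k=0$. $R(N)$ denotes the maximum size of a set $A\subseteq\{1,\dots,N\}$ such that the equation has no solution with $x_1,\dots,x_k\in A$ pairwise distinct. $\mathbb{Z}_N=\mathbb{Z}/N\mathbb{Z}$. For a set $\Gamma=\{\gamma_1,\dots,\gamma_d\}$ of characters of $\mathbb{Z}_N$ and $\varepsilon\in(0,1]^d$, the Bohr set is $B(\Gamma,\varepsilon)=\{n:\|\gamma_j(n)\|<\varepsilon_j\ \forall j\}$ where $\|x\|=|\arg x|/2\pi$; its dimension is $|\Gamma|$. Logarithms are to base $2$. *)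

theory Defs
  imports "HOL-Analysis.Analysis" "HOL-Algebra.Elementary_Groups"
begin

definition circle_group :: "complex monoid" where
  "circle_group = \<lparr>carrier = {z. cmod z = 1}, monoid.mult = (*), one = 1\<rparr>"

text \<open>
  The group of residues modulo \<open>N\<close> is \<^const>\<open>integer_mod_group\<close>, with carrier \<open>{0..<int N}\<close> for
  \<open>N \<ge> 1\<close>. Characters are taken extensional, so that distinct functions are distinct characters
  and \<open>card \<Gamma>\<close> is the number of characters in \<open>\<Gamma>\<close>.
\<close>

definition characters :: "nat \<Rightarrow> (int \<Rightarrow> complex) set" where
  "characters N =
     hom (integer_mod_group N) circle_group \<inter> extensional (carrier (integer_mod_group N))"

definition circle_norm :: "complex \<Rightarrow> real" where
  "circle_norm z = \<bar>Arg z\<bar> / (2 * pi)"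

definition bohr_set :: "nat \<Rightarrow> (int \<Rightarrow> complex) set \<Rightarrow> ((int \<Rightarrow> complex) \<Rightarrow> real) \<Rightarrow> int set" where
  "bohr_set N \<Gamma> \<epsilon> =
     {n \<in> carrier (integer_mod_group N). \<forall>\<gamma>\<in>\<Gamma>. circle_norm (\<gamma> n) < \<epsilon> \<gamma>}"

text \<open>
  The dimension belongs to the presentation \<open>(\<Gamma>, \<epsilon>)\<close>, hence the predicate says that \<open>B\<close> admits a
  presentation with \<open>d\<close> characters.
\<close>

definition is_bohr_set :: "nat \<Rightarrow> nat \<Rightarrow> int set \<Rightarrow> bool" where
  "is_bohr_set N d B \<longleftrightarrow>
     (\<exists>\<Gamma> \<epsilon>. \<Gamma> \<subseteq> characters N \<and> finite \<Gamma> \<and> card \<Gamma> = d \<and>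
        (\<forall>\<gamma>\<in>\<Gamma>. 0 < \<epsilon> \<gamma> \<and> \<epsilon> \<gamma> \<le> 1) \<and> B = bohr_set N \<Gamma> \<epsilon>)"

definition double_difference :: "nat \<Rightarrow> int set \<Rightarrow> int set \<Rightarrow> int set" where
  "double_difference N A A' =
     {(a - a\<^sub>0 + a' - a'\<^sub>0) mod int N | a a\<^sub>0 a' a'\<^sub>0. a \<in> A \<and> a\<^sub>0 \<in> A \<and> a' \<in> A' \<and> a'\<^sub>0 \<in> A'}"

definition representations :: "nat \<Rightarrow> int set \<Rightarrow> int set \<Rightarrow> int \<Rightarrow> (int \<times> int \<times> int \<times> int) set" where
  "representations N A A' b =
     {(a, a\<^sub>0, a', a'\<^sub>0). a \<in> A \<and> a\<^sub>0 \<in> A \<and> a' \<in> A' \<and> a'\<^sub>0 \<in> A' \<and>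
        b = (a - a\<^sub>0 + a' - a'\<^sub>0) mod int N}"

text \<open>
  The function \<open>\<eta>\<close> is \<open>c \<mapsto> c'\<close>. The constants \<open>K\<^sub>1\<close>, \<open>K\<^sub>2\<close> implied by the two \<open>\<ggreater>\<close> may depend
  on \<open>c\<close>, but not on \<open>N\<close>, \<open>A\<close>, \<open>A'\<close>; the hypothesis with absolute constants implies this one.
\<close>

definition bohr_hypothesis :: bool where
  "bohr_hypothesis \<longleftrightarrow>
     (\<exists>\<delta> \<eta> :: real \<Rightarrow> real.
        (\<delta> \<longlongrightarrow> 0) (at_right 0) \<and> (\<eta> \<longlongrightarrow> 0) (at_right 0) \<and>
        (\<forall>c>0. \<delta> c > 0 \<and> \<eta> c > 0 \<and>
          (\<exists>K\<^sub>1>0. \<exists>K\<^sub>2>0. \<forall>N\<ge>1. \<forall>A A'.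
             A \<subseteq> carrier (integer_mod_group N) \<and> A' \<subseteq> carrier (integer_mod_group N) \<and>
             real (card A) \<ge> real N powr (1 - c) \<and> real (card A') \<ge> real N powr (1 - c) \<longrightarrow>
             (\<exists>B d. is_bohr_set N d B \<and> real d \<le> \<delta> c * log 2 (real N) \<and>
                B \<subseteq> double_difference N A A' \<and>
                real (card B) \<ge> K\<^sub>1 * real N powr (1 - \<eta> c) \<and>
                (\<forall>b\<in>B. real (card (representations N A A' b))
                   \<ge> K\<^sub>2 * (real (card A))\<^sup>2 * (real (card A'))\<^sup>2 / real N)))))"

text \<open>The equation \<open>a\<^sub>1 x\<^sub>1 + \<dots> + a\<^sub>k x\<^sub>k = 0\<close> is given by \<open>k\<close> and the values of \<open>a\<close> on \<open>{1..k}\<close>.\<close>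

definition invariant_equation :: "nat \<Rightarrow> (nat \<Rightarrow> int) \<Rightarrow> bool" where
  "invariant_equation k a \<longleftrightarrow> (\<Sum>i=1..k. a i) = 0"

definition has_distinct_solution :: "nat \<Rightarrow> (nat \<Rightarrow> int) \<Rightarrow> int set \<Rightarrow> bool" where
  "has_distinct_solution k a A \<longleftrightarrow>
     (\<exists>x. (\<forall>i\<in>{1..k}. x i \<in> A) \<and> inj_on x {1..k} \<and> (\<Sum>i=1..k. a i * x i) = 0)"

definition R :: "nat \<Rightarrow> (nat \<Rightarrow> int) \<Rightarrow> nat \<Rightarrow> nat" where
  "R k a N = Max (card ` {A. A \<subseteq> {1..int N} \<and> \<not> has_distinct_solution k a A})"

end

theory Submission
  imports Defs "HOL-Real_Asymp.Real_Asymp"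
begin

text \<open>
  Let \<open>A \<subseteq> {1..N}\<close> be large and put \<open>M = s N + 1\<close> with \<open>s = \<Sum>\<bar>a i\<bar>\<close>, so that for variables in \<open>A\<close> the
  equation modulo \<open>M\<close> is equivalent to the equation over the integers, and multiplication by any
  \<open>a i\<close> is injective from \<open>A\<close> into the residues modulo \<open>M\<close>. The hypothesis, applied to the
  dilates \<open>a 1 \<cdot> A\<close> and \<open>a 3 \<cdot> A\<close>, gives a Bohr set \<open>B\<close> of dimension \<open>d \<le> \<delta> log M\<close> all of whose elements
  are popularly represented as \<open>a 1 (x\<^sub>1 - x\<^sub>2) + a 3 (x\<^sub>3 - x\<^sub>4)\<close>. Dividing the radii by \<open>s + 1\<close> costs
  only a factor \<open>(2 (s + 1)) ^ d\<close>, a small power of \<open>M\<close>, so some translate \<open>t + B'\<close> of the shrunk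
  Bohr set contains \<open>k\<close> elements of \<open>A\<close>. Choose \<open>x\<^sub>5, \<dots>, x\<^sub>k\<close> among them. As \<open>a 5 + \<dots> + a k = 0\<close>, the
  translation cancels and \<open>- (a 5 x\<^sub>5 + \<dots> + a k x\<^sub>k)\<close> lies in \<open>B\<close>. Its representations outnumber the
  \<open>O(\<bar>A\<bar>\<^sup>2)\<close> quadruples \<open>(x\<^sub>1, x\<^sub>2, x\<^sub>3, x\<^sub>4)\<close> with a coincidence.
\<close>

section \<open>Characters of the residues modulo \<open>N\<close> and the circle norm\<close>

text \<open>Composed with reduction modulo \<open>N\<close>, a character is a homomorphism from the
  integers to the unit circle and hence fixed by the image of 1; \<open>\<phi>\<close> is an
  argument of that image. Arithmetic of residues thereby becomes arithmetic of real phases.\<close>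

lemma character_eq_cis:
  assumes "\<gamma> \<in> characters N" "N \<ge> 1"
  obtains \<phi> where "\<And>n. \<gamma> (n mod int N) = cis (\<phi> * of_int n)"
proof -
  define X where "X n = \<gamma> (n mod int N)" for n
  have carr: "n mod int N \<in> carrier (integer_mod_group N)" for n
    using assms(2) by (simp add: carrier_integer_mod_group)
  have hom: "\<gamma> \<in> hom (integer_mod_group N) circle_group"
    using assms(1) by (simp add: characters_def)
  have norm: "cmod (X n) = 1" for n
    using hom_in_carrier[OF hom carr[of n]] by (simp add: X_def circle_group_def)
  have add: "X (m + n) = X m * X n" for m n
    using hom_mult[OF hom carr[of m] carr[of n]] by (simp add: X_def circle_group_def mod_add_eq)
  define \<phi> where "\<phi> = Arg (X 1)"
  have one: "X 1 = cis \<phi>"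
    using norm[of 1] by (subst \<phi>_def, subst cis_Arg) (auto simp: sgn_div_norm)
  have "X n = cis (\<phi> * of_int n)" for n
  proof (induction n rule: int_induct[where k = 0])
    case base
    have "X 0 = X 0 * X 0" "X 0 \<noteq> 0" using add[of 0 0] norm[of 0] by auto
    then show ?case by simp
  next
    case (step1 i)
    then show ?case by (simp add: add one cis_mult algebra_simps)
  next
    case (step2 i)
    have "X (i - 1) * cis \<phi> = cis (\<phi> * of_int (i - 1)) * cis \<phi>"
      using add[of "i - 1" 1] step2 by (simp add: one cis_mult algebra_simps)
    then show ?case by simp
  qed
  then show ?thesis using that by (simp add: X_def)
qed

text \<open>\<open>Arg\<close> picks, among the numbers congruent to \<open>t\<close> modulo
  \<open>2 * pi\<close>, one of least absolute value.\<close>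

lemma circle_norm_cis_le: "circle_norm (cis t) \<le> \<bar>t\<bar> / (2 * pi)"
proof (cases "t \<in> {-pi<..pi}")
  case True
  then show ?thesis by (simp add: circle_norm_def Arg_cis)
next
  case False
  then have "\<bar>Arg (cis t)\<bar> \<le> \<bar>t\<bar>" using Arg_bounded[of "cis t"] by auto
  then show ?thesis by (simp add: circle_norm_def divide_right_mono)
qed

text \<open>Measured in full turns, \<open>circle_norm\<close> is the distance of a phase from the
  nearest integer, so it inherits the triangle inequality and grows at most linearly under integer
  multiples.\<close>

lemma circle_norm_character_sum_le:
  assumes "\<gamma> \<in> characters N" "N \<ge> 1" "finite I"
  shows "circle_norm (\<gamma> ((\<Sum>i\<in>I. a i * y i) mod int N))
    \<le> (\<Sum>i\<in>I. \<bar>of_int (a i)\<bar> * circle_norm (\<gamma> (y i mod int N)))"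
proof -
  obtain \<phi> where \<phi>: "\<And>n. \<gamma> (n mod int N) = cis (\<phi> * of_int n)"
    using character_eq_cis assms by blast
  \<comment> \<open>The principal value \<open>t i\<close> differs from the phase
    \<open>\<phi> * y i\<close> by a multiple of \<open>2 * pi\<close>, and multiplication by the
    integer \<open>a i\<close> preserves this congruence.\<close>
  define t where "t i = Arg (\<gamma> (y i mod int N))" for i
  have t: "cis (t i) = cis (\<phi> * of_int (y i))" for i
    by (simp add: t_def \<phi> cis_Arg sgn_div_norm)
  have ti: "cis (of_int (a i) * t i) = cis (of_int (a i) * (\<phi> * of_int (y i)))" for i
    by (metis t cis_power_int)
  have "\<gamma> ((\<Sum>i\<in>I. a i * y i) mod int N) = cis (\<Sum>i\<in>I. of_int (a i) * (\<phi> * of_int (y i)))"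
    by (simp add: \<phi> sum_distrib_left mult_ac)
  also have "\<dots> = cis (\<Sum>i\<in>I. of_int (a i) * t i)"
    using assms(3) by (induction) (simp_all add: cis_mult[symmetric] ti)
  finally have "circle_norm (\<gamma> ((\<Sum>i\<in>I. a i * y i) mod int N))
      \<le> \<bar>\<Sum>i\<in>I. of_int (a i) * t i\<bar> / (2 * pi)"
    using circle_norm_cis_le by simp
  also have "\<dots> \<le> (\<Sum>i\<in>I. \<bar>of_int (a i) * t i\<bar>) / (2 * pi)"
    by (intro divide_right_mono sum_abs) simp
  finally show ?thesis
    by (simp add: circle_norm_def t_def abs_mult sum_divide_distrib)
qed

section \<open>Bohr sets: integer combinations and shrunk radii\<close>

text \<open>The triangle inequality loses at most the total weight of the coefficients, and dividing
  the radii by \<open>s\<close> pays for it. That \<open>s\<close> strictly exceeds the weight keeps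
  the final bound strict, even for an empty sum.\<close>

lemma bohr_set_weighted_sum:
  assumes "\<Gamma> \<subseteq> characters N" "N \<ge> 1" "finite I" "\<And>\<gamma>. \<gamma> \<in> \<Gamma> \<Longrightarrow> 0 < \<epsilon> \<gamma>"
    and s: "(\<Sum>i\<in>I. \<bar>a i\<bar>) < int s"
    and y: "\<And>i. i \<in> I \<Longrightarrow> y i \<in> bohr_set N \<Gamma> (\<lambda>\<gamma>. \<epsilon> \<gamma> / real s)"
  shows "(\<Sum>i\<in>I. a i * y i) mod int N \<in> bohr_set N \<Gamma> \<epsilon>"
proof -
  have "circle_norm (\<gamma> ((\<Sum>i\<in>I. a i * y i) mod int N)) < \<epsilon> \<gamma>" if \<gamma>: "\<gamma> \<in> \<Gamma>" for \<gamma>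
  proof -
    have yi: "circle_norm (\<gamma> (y i mod int N)) \<le> \<epsilon> \<gamma> / real s" if "i \<in> I" for i
      using y[OF that] \<gamma> assms(2)
      by (auto simp: bohr_set_def carrier_integer_mod_group less_imp_le)
    have pos: "0 < real s" using s sum_abs_ge_zero[of a I] by linarith
    have "circle_norm (\<gamma> ((\<Sum>i\<in>I. a i * y i) mod int N))
        \<le> (\<Sum>i\<in>I. \<bar>of_int (a i)\<bar> * circle_norm (\<gamma> (y i mod int N)))"
      using \<gamma> assms by (intro circle_norm_character_sum_le) auto
    also have "\<dots> \<le> (\<Sum>i\<in>I. \<bar>of_int (a i)\<bar> * (\<epsilon> \<gamma> / real s))"
      by (intro sum_mono mult_left_mono yi) auto
    also have "\<dots> = of_int (\<Sum>i\<in>I. \<bar>a i\<bar>) * (\<epsilon> \<gamma> / real s)"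
      by (simp add: sum_distrib_right sum_divide_distrib)
    also have "\<dots> < real s * (\<epsilon> \<gamma> / real s)"
      using s assms(4)[OF \<gamma>] pos by (intro mult_strict_right_mono) (auto simp flip: of_int_sum of_int_abs)
    finally show ?thesis using pos by simp
  qed
  then show ?thesis using assms(2) by (simp add: bohr_set_def carrier_integer_mod_group)
qed

lemma finite_bohr_set: "N \<ge> 1 \<Longrightarrow> finite (bohr_set N \<Gamma> \<epsilon>)"
  by (rule finite_subset[of _ "{0..<int N}"]) (auto simp: bohr_set_def carrier_integer_mod_group)

text \<open>Pigeonhole: the phases of the Bohr set lie in a box with sides
  \<open>2 * \<epsilon> \<gamma>\<close>, which is cut into cells with sides
  \<open>\<epsilon> \<gamma> / s\<close>, that is \<open>2 * s\<close> intervals in each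
  direction.\<close>

lemma card_bohr_set_le_shrunk:
  assumes \<Gamma>: "\<Gamma> \<subseteq> characters N" "finite \<Gamma>" and N: "N \<ge> 1" and s: "s \<ge> 1"
    and \<epsilon>: "\<And>\<gamma>. \<gamma> \<in> \<Gamma> \<Longrightarrow> 0 < \<epsilon> \<gamma>"
  shows "card (bohr_set N \<Gamma> \<epsilon>)
    \<le> (2 * s) ^ card \<Gamma> * card (bohr_set N \<Gamma> (\<lambda>\<gamma>. \<epsilon> \<gamma> / real s))"
proof -
  let ?B = "bohr_set N \<Gamma> \<epsilon>" and ?B' = "bohr_set N \<Gamma> (\<lambda>\<gamma>. \<epsilon> \<gamma> / real s)"
  \<comment> \<open>Phases are rescaled so that the cells become unit cubes: on the Bohr set
    \<open>u\<close> lies strictly between \<open>- s\<close> and \<open>s\<close>, and the floors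
    in \<open>h\<close> name the cell.\<close>
  define u where "u \<gamma> n = real s * (Arg (\<gamma> n) / (2 * pi)) / \<epsilon> \<gamma>" for \<gamma> and n :: int
  define h where "h n = (\<lambda>\<gamma>\<in>\<Gamma>. \<lfloor>u \<gamma> n\<rfloor>)" for n
  define V where "V = \<Gamma> \<rightarrow>\<^sub>E {- int s..<int s}"
  have hV: "h n \<in> V" if n: "n \<in> ?B" for n
  proof -
    have "\<lfloor>u \<gamma> n\<rfloor> \<in> {- int s..<int s}" if "\<gamma> \<in> \<Gamma>" for \<gamma>
    proof -
      have "\<bar>Arg (\<gamma> n) / (2 * pi)\<bar> < \<epsilon> \<gamma>"
        using n that by (auto simp: bohr_set_def circle_norm_def)
      then have "real s * \<bar>Arg (\<gamma> n) / (2 * pi)\<bar> < real s * \<epsilon> \<gamma>"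
        using s by (intro mult_strict_left_mono) auto
      then have "\<bar>u \<gamma> n\<bar> < real s"
        using \<epsilon>[OF that] unfolding u_def by (simp add: abs_mult abs_divide pos_divide_less_eq mult_ac)
      then show ?thesis by (auto simp: le_floor_iff floor_less_iff)
    qed
    then show ?thesis by (auto simp: h_def V_def)
  qed
  \<comment> \<open>Two elements in the same cell differ by an element of the shrunk Bohr set.\<close>
  have fibre: "card {n \<in> ?B. h n = v} \<le> card ?B'" for v
  proof (cases "{n \<in> ?B. h n = v} = {}")
    case False
    then obtain m where m: "m \<in> ?B" "h m = v" by auto
    \<comment> \<open>Subtracting the fixed member \<open>m\<close> maps the whole fibre injectively
      into the shrunk Bohr set.\<close>
    have "inj_on (\<lambda>n. (n - m) mod int N) {n \<in> ?B. h n = v}"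
    proof (rule inj_onI)
      fix x y assume xy: "x \<in> {n \<in> ?B. h n = v}" "y \<in> {n \<in> ?B. h n = v}"
        and eq: "(x - m) mod int N = (y - m) mod int N"
      have "x mod int N = y mod int N"
        using eq by (metis diff_add_cancel mod_add_left_eq)
      then show "x = y" using xy N by (auto simp: bohr_set_def carrier_integer_mod_group)
    qed
    moreover have "(n - m) mod int N \<in> ?B'" if n: "n \<in> ?B" "h n = v" for n
    proof -
      have "circle_norm (\<gamma> ((n - m) mod int N)) < \<epsilon> \<gamma> / real s" if \<gamma>: "\<gamma> \<in> \<Gamma>" for \<gamma>
      proof -
        obtain \<phi> where \<phi>: "\<And>n. \<gamma> (n mod int N) = cis (\<phi> * of_int n)"
          using character_eq_cis \<Gamma> \<gamma> N by blast
        have cis: "\<gamma> x = cis (\<phi> * of_int x)" "cis (Arg (\<gamma> x)) = \<gamma> x" if "x \<in> ?B" for x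
        proof -
          show "\<gamma> x = cis (\<phi> * of_int x)"
            using \<phi>[of x] that N by (auto simp: bohr_set_def carrier_integer_mod_group)
          then show "cis (Arg (\<gamma> x)) = \<gamma> x" by (simp add: cis_Arg sgn_div_norm)
        qed
        have "\<gamma> ((n - m) mod int N) = cis (Arg (\<gamma> n) - Arg (\<gamma> m))"
          using cis[OF n(1)] cis[OF m(1)] by (simp add: \<phi> cis_divide[symmetric] algebra_simps)
        then have 1: "circle_norm (\<gamma> ((n - m) mod int N)) \<le> \<bar>Arg (\<gamma> n) - Arg (\<gamma> m)\<bar> / (2 * pi)"
          using circle_norm_cis_le by simp
        have "\<lfloor>u \<gamma> n\<rfloor> = \<lfloor>u \<gamma> m\<rfloor>"
          using n(2) m(2) \<gamma> unfolding h_def by (metis restrict_apply')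
        then have "\<bar>u \<gamma> n - u \<gamma> m\<bar> < 1" by linarith
        moreover have "u \<gamma> n - u \<gamma> m = (Arg (\<gamma> n) - Arg (\<gamma> m)) / (2 * pi) * (real s / \<epsilon> \<gamma>)"
          unfolding u_def using \<epsilon>[OF \<gamma>] by (simp add: field_simps)
        ultimately have "\<bar>Arg (\<gamma> n) - Arg (\<gamma> m)\<bar> / (2 * pi) * (real s / \<epsilon> \<gamma>) < 1"
          using \<epsilon>[OF \<gamma>] by (simp add: abs_mult)
        then have "\<bar>Arg (\<gamma> n) - Arg (\<gamma> m)\<bar> / (2 * pi) < \<epsilon> \<gamma> / real s"
          using \<epsilon>[OF \<gamma>] s by (simp add: field_simps)
        with 1 show ?thesis by simp
      qed
      then show ?thesis using N by (simp add: bohr_set_def carrier_integer_mod_group)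
    qed
    ultimately show ?thesis
      by (intro card_inj_on_le[where f = "\<lambda>n. (n - m) mod int N"] finite_bohr_set N) auto
  next
    case True
    then show ?thesis by (simp only: card.empty)
  qed
  have finV: "finite V" unfolding V_def using \<Gamma> by (intro finite_PiE) auto
  have "?B = (\<Union>v\<in>V. {n \<in> ?B. h n = v})" using hV by auto
  then have "card ?B \<le> (\<Sum>v\<in>V. card {n \<in> ?B. h n = v})"
    using card_UN_le[OF finV] by metis
  also have "\<dots> \<le> card V * card ?B'"
    using sum_bounded_above[of V "\<lambda>v. card {n \<in> ?B. h n = v}" "card ?B'"] fibre by simp
  also have "card V = (2 * s) ^ card \<Gamma>"
  proof -
    have "card {- int s..<int s} = 2 * s" unfolding card_atLeastLessThan_int by linarith
    then show ?thesis unfolding V_def using \<Gamma> by (simp only: card_PiE prod_constant)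
  qed
  finally show ?thesis .
qed

section \<open>Counting: a rich translate, and degenerate quadruples\<close>

text \<open>Averaging over \<open>t\<close>: each \<open>x\<close> lies in exactly
  \<open>card B\<close> of the \<open>N\<close> translates of \<open>B\<close>, so the intersections
  with \<open>A\<close> have mean size \<open>card A * card B / N\<close>, and some translate
  reaches the mean.\<close>

lemma exists_translate_card_Int_ge:
  assumes N: "N \<ge> 1" and A: "A \<subseteq> {0..<int N}" and B: "B \<subseteq> {0..<int N}"
  obtains t where "card A * card B \<le> N * card {x \<in> A. (x - t) mod int N \<in> B}"
proof -
  let ?Z = "{0..<int N}"
  have fin: "finite A" "finite B" using A B finite_subset by blast+
  have "card {t \<in> ?Z. (x - t) mod int N \<in> B} = card B" for x
  proof (rule bij_betw_same_card)
    \<comment> \<open>The reflection of \<open>t\<close> to \<open>x - t\<close> modulo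
      \<open>N\<close> is its own inverse.\<close>
    have inv: "(x - (x - t) mod int N) mod int N = t" if "t \<in> ?Z" for t
      using that by (simp add: mod_diff_right_eq)
    then show "bij_betw (\<lambda>t. (x - t) mod int N) {t \<in> ?Z. (x - t) mod int N \<in> B} B"
      using B N by (intro bij_betwI[where g = "\<lambda>b. (x - b) mod int N"]) (auto simp: subset_iff)
  qed
  then have "card A * card B = (\<Sum>x\<in>A. card {t \<in> ?Z. (x - t) mod int N \<in> B})" by simp
  also have "\<dots> = (\<Sum>t\<in>?Z. card {x \<in> A. (x - t) mod int N \<in> B})"
    using fin by (intro sum_multicount_gen) auto
  finally have sum: "card A * card B = (\<Sum>t\<in>?Z. card {x \<in> A. (x - t) mod int N \<in> B})" .
  show ?thesis
  proof (rule ccontr)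
    assume "\<not> thesis"
    then have "N * card {x \<in> A. (x - t) mod int N \<in> B} < card A * card B" for t
      using that by (meson not_le)
    then have "(\<Sum>t\<in>?Z. N * card {x \<in> A. (x - t) mod int N \<in> B}) < (\<Sum>t\<in>?Z. card A * card B)"
      using N by (intro sum_strict_mono) auto
    also have "\<dots> = N * (card A * card B)" by simp
    finally show False using sum by (simp flip: sum_distrib_left)
  qed
qed

text \<open>The constant counts the ways to be degenerate: 6 pairs of coordinates may coincide, and
  each of 4 coordinates may take one of \<open>card E\<close> forbidden values. Each way accounts
  for at most \<open>(card A)\<^sup>2\<close> solutions.\<close>

lemma exists_nondegenerate_quadruple:
  fixes A E :: "int set" and M p q b :: int
  assumes "finite A" "finite E"
    and p: "\<And>x y. x \<in> A \<Longrightarrow> y \<in> A \<Longrightarrow> M dvd p * (x - y) \<Longrightarrow> x = y"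
    and q: "\<And>x y. x \<in> A \<Longrightarrow> y \<in> A \<Longrightarrow> M dvd q * (x - y) \<Longrightarrow> x = y"
    and large: "(6 + 4 * card E) * (card A)\<^sup>2
      < card {(x\<^sub>1, x\<^sub>2, x\<^sub>3, x\<^sub>4). x\<^sub>1 \<in> A \<and> x\<^sub>2 \<in> A \<and> x\<^sub>3 \<in> A \<and> x\<^sub>4 \<in> A \<and>
          M dvd p * x\<^sub>1 - p * x\<^sub>2 + q * x\<^sub>3 - q * x\<^sub>4 - b}"
  obtains x\<^sub>1 x\<^sub>2 x\<^sub>3 x\<^sub>4 where "x\<^sub>1 \<in> A - E" "x\<^sub>2 \<in> A - E" "x\<^sub>3 \<in> A - E" "x\<^sub>4 \<in> A - E"
    "distinct [x\<^sub>1, x\<^sub>2, x\<^sub>3, x\<^sub>4]" "M dvd p * x\<^sub>1 - p * x\<^sub>2 + q * x\<^sub>3 - q * x\<^sub>4 - b"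
proof -
  define S where "S = {(x\<^sub>1, x\<^sub>2, x\<^sub>3, x\<^sub>4). x\<^sub>1 \<in> A \<and> x\<^sub>2 \<in> A \<and> x\<^sub>3 \<in> A \<and> x\<^sub>4 \<in> A \<and>
          M dvd p * x\<^sub>1 - p * x\<^sub>2 + q * x\<^sub>3 - q * x\<^sub>4 - b}"
  have A: "x\<^sub>1 \<in> A" "x\<^sub>2 \<in> A" "x\<^sub>3 \<in> A" "x\<^sub>4 \<in> A" if "(x\<^sub>1, x\<^sub>2, x\<^sub>3, x\<^sub>4) \<in> S" for x\<^sub>1 x\<^sub>2 x\<^sub>3 x\<^sub>4
    using that by (auto simp: S_def)
  \<comment> \<open>Three coordinates of a solution determine the fourth, so each type of coincidence leaves two
    degrees of freedom.\<close>
  have det2: "x = y" if "(x\<^sub>1, x, x\<^sub>3, x\<^sub>4) \<in> S" "(x\<^sub>1, y, x\<^sub>3, x\<^sub>4) \<in> S" for x\<^sub>1 x\<^sub>3 x\<^sub>4 x y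
  proof -
    have "M dvd (p * x\<^sub>1 - p * y + q * x\<^sub>3 - q * x\<^sub>4 - b) - (p * x\<^sub>1 - p * x + q * x\<^sub>3 - q * x\<^sub>4 - b)"
      by (rule dvd_diff) (use that in \<open>auto simp: S_def\<close>)
    then show ?thesis using that by (intro p A) (auto simp: algebra_simps)
  qed
  have det3: "x = y" if "(x\<^sub>1, x\<^sub>2, x, x\<^sub>4) \<in> S" "(x\<^sub>1, x\<^sub>2, y, x\<^sub>4) \<in> S" for x\<^sub>1 x\<^sub>2 x\<^sub>4 x y
  proof -
    have "M dvd (p * x\<^sub>1 - p * x\<^sub>2 + q * x - q * x\<^sub>4 - b) - (p * x\<^sub>1 - p * x\<^sub>2 + q * y - q * x\<^sub>4 - b)"
      by (rule dvd_diff) (use that in \<open>auto simp: S_def\<close>)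
    then show ?thesis using that by (intro q A) (auto simp: algebra_simps)
  qed
  have det4: "x = y" if "(x\<^sub>1, x\<^sub>2, x\<^sub>3, x) \<in> S" "(x\<^sub>1, x\<^sub>2, x\<^sub>3, y) \<in> S" for x\<^sub>1 x\<^sub>2 x\<^sub>3 x y
  proof -
    have "M dvd (p * x\<^sub>1 - p * x\<^sub>2 + q * x\<^sub>3 - q * y - b) - (p * x\<^sub>1 - p * x\<^sub>2 + q * x\<^sub>3 - q * x - b)"
      by (rule dvd_diff) (use that in \<open>auto simp: S_def\<close>)
    then show ?thesis using that by (intro q A) (auto simp: algebra_simps)
  qed
  have finS: "finite S"
    by (rule finite_subset[of _ "A \<times> A \<times> A \<times> A"]) (use assms A in auto)
  have le: "card T \<le> (card A)\<^sup>2" if "inj_on f T" "f ` T \<subseteq> A \<times> A" for T and f :: "_ \<Rightarrow> int \<times> int"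
    using card_inj_on_le[OF that] assms(1) by (simp add: card_cartesian_product power2_eq_square)
  \<comment> \<open>Each degenerate class is projected to two coordinates chosen so that the
    coincidence or the forbidden value supplies a third one and the congruence the last. The choice
    matters: on \<open>?T24\<close>, keeping \<open>x\<^sub>1\<close> and \<open>x\<^sub>3\<close>
    would leave an unknown with coefficient \<open>p + q\<close>, about which nothing is
    assumed.\<close>
  let ?f12 = "\<lambda>(x\<^sub>1, x\<^sub>2, x\<^sub>3, x\<^sub>4). (x\<^sub>1, x\<^sub>2) :: int \<times> int"
  let ?f13 = "\<lambda>(x\<^sub>1, x\<^sub>2, x\<^sub>3, x\<^sub>4). (x\<^sub>1, x\<^sub>3) :: int \<times> int"
  let ?f23 = "\<lambda>(x\<^sub>1, x\<^sub>2, x\<^sub>3, x\<^sub>4). (x\<^sub>2, x\<^sub>3) :: int \<times> int"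
  let ?T12 = "{(x\<^sub>1, x\<^sub>2, x\<^sub>3, x\<^sub>4) \<in> S. x\<^sub>1 = x\<^sub>2}" and ?T34 = "{(x\<^sub>1, x\<^sub>2, x\<^sub>3, x\<^sub>4) \<in> S. x\<^sub>3 = x\<^sub>4}"
  let ?T13 = "{(x\<^sub>1, x\<^sub>2, x\<^sub>3, x\<^sub>4) \<in> S. x\<^sub>1 = x\<^sub>3}" and ?T14 = "{(x\<^sub>1, x\<^sub>2, x\<^sub>3, x\<^sub>4) \<in> S. x\<^sub>1 = x\<^sub>4}"
  let ?T23 = "{(x\<^sub>1, x\<^sub>2, x\<^sub>3, x\<^sub>4) \<in> S. x\<^sub>2 = x\<^sub>3}" and ?T24 = "{(x\<^sub>1, x\<^sub>2, x\<^sub>3, x\<^sub>4) \<in> S. x\<^sub>2 = x\<^sub>4}"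
  let ?U1 = "\<lambda>e. {(x\<^sub>1, x\<^sub>2, x\<^sub>3, x\<^sub>4) \<in> S. x\<^sub>1 = e}" and ?U2 = "\<lambda>e. {(x\<^sub>1, x\<^sub>2, x\<^sub>3, x\<^sub>4) \<in> S. x\<^sub>2 = e}"
  let ?U3 = "\<lambda>e. {(x\<^sub>1, x\<^sub>2, x\<^sub>3, x\<^sub>4) \<in> S. x\<^sub>3 = e}" and ?U4 = "\<lambda>e. {(x\<^sub>1, x\<^sub>2, x\<^sub>3, x\<^sub>4) \<in> S. x\<^sub>4 = e}"
  let ?T = "?T12 \<union> ?T34 \<union> ?T13 \<union> ?T14 \<union> ?T23 \<union> ?T24"
  let ?U = "\<lambda>e. ?U1 e \<union> ?U2 e \<union> ?U3 e \<union> ?U4 e"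
  have T: "card ?T12 \<le> (card A)\<^sup>2" "card ?T34 \<le> (card A)\<^sup>2" "card ?T13 \<le> (card A)\<^sup>2"
      "card ?T14 \<le> (card A)\<^sup>2" "card ?T23 \<le> (card A)\<^sup>2" "card ?T24 \<le> (card A)\<^sup>2"
    by (rule le[of ?f13] le[of ?f12]; auto intro!: inj_onI dest: A det2 det3 det4)+
  have U: "card (?U1 e) \<le> (card A)\<^sup>2" "card (?U2 e) \<le> (card A)\<^sup>2" "card (?U3 e) \<le> (card A)\<^sup>2"
      "card (?U4 e) \<le> (card A)\<^sup>2" for e
    by (rule le[of ?f23], auto intro!: inj_onI dest: A det4)
      (rule le[of ?f13], auto intro!: inj_onI dest: A det4,
       rule le[of ?f12], auto intro!: inj_onI dest: A det4,
       rule le[of ?f12], auto intro!: inj_onI dest: A det3)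
  have cT: "card ?T \<le> 6 * (card A)\<^sup>2"
  proof -
    have "card ?T \<le> card ?T12 + card ?T34 + card ?T13 + card ?T14 + card ?T23 + card ?T24"
      by (intro card_Un_le[THEN order_trans] add_mono order_refl)
    then show ?thesis using T by linarith
  qed
  have cU: "card (?U e) \<le> 4 * (card A)\<^sup>2" for e
  proof -
    have "card (?U e) \<le> card (?U1 e) + card (?U2 e) + card (?U3 e) + card (?U4 e)"
      by (intro card_Un_le[THEN order_trans] add_mono order_refl)
    then show ?thesis using U[of e] by linarith
  qed
  have "card (\<Union>e\<in>E. ?U e) \<le> (\<Sum>e\<in>E. card (?U e))"
    by (rule card_UN_le[OF assms(2)])
  also have "\<dots> \<le> card E * (4 * (card A)\<^sup>2)"
    using sum_bounded_above[of E "\<lambda>e. card (?U e)" "4 * (card A)\<^sup>2"] cU by simp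
  finally have "card (\<Union>e\<in>E. ?U e) \<le> card E * (4 * (card A)\<^sup>2)" .
  with cT have "card (?T \<union> (\<Union>e\<in>E. ?U e)) \<le> 6 * (card A)\<^sup>2 + card E * (4 * (card A)\<^sup>2)"
    by (rule order_trans[OF card_Un_le add_mono])
  also have "\<dots> < card S"
    using large unfolding S_def by (simp add: algebra_simps)
  finally have "card (?T \<union> (\<Union>e\<in>E. ?U e)) < card S" .
  moreover have "finite (?T \<union> (\<Union>e\<in>E. ?U e))"
    by (rule finite_subset[OF _ finS]) auto
  ultimately have "\<not> S \<subseteq> ?T \<union> (\<Union>e\<in>E. ?U e)"
    using card_mono by (meson not_le)
  then obtain r where r: "r \<in> S" "r \<notin> ?T \<union> (\<Union>e\<in>E. ?U e)" by blast
  obtain x\<^sub>1 x\<^sub>2 x\<^sub>3 x\<^sub>4 where x: "r = (x\<^sub>1, x\<^sub>2, x\<^sub>3, x\<^sub>4)" by (cases r)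
  have "x\<^sub>1 \<noteq> x\<^sub>2" "x\<^sub>3 \<noteq> x\<^sub>4" "x\<^sub>1 \<noteq> x\<^sub>3" "x\<^sub>1 \<noteq> x\<^sub>4" "x\<^sub>2 \<noteq> x\<^sub>3" "x\<^sub>2 \<noteq> x\<^sub>4"
    "x\<^sub>1 \<notin> E" "x\<^sub>2 \<notin> E" "x\<^sub>3 \<notin> E" "x\<^sub>4 \<notin> E"
    using r unfolding x by blast+
  moreover have "x\<^sub>1 \<in> A" "x\<^sub>2 \<in> A" "x\<^sub>3 \<in> A" "x\<^sub>4 \<in> A"
    "M dvd p * x\<^sub>1 - p * x\<^sub>2 + q * x\<^sub>3 - q * x\<^sub>4 - b"
    using r unfolding x S_def by simp_all
  ultimately show ?thesis by (intro that[of x\<^sub>1 x\<^sub>2 x\<^sub>3 x\<^sub>4]) simp_all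
qed

section \<open>Passing between residues modulo \<open>M\<close> and integers\<close>

text \<open>A multiple of \<open>M\<close> of absolute value below \<open>M\<close> vanishes. This
  makes dilation by a coefficient of the equation injective modulo \<open>M\<close>.\<close>

lemma dvd_mult_diff_imp_eq:
  fixes p x y M N :: int
  assumes "M dvd p * (x - y)" "x \<in> {1..N}" "y \<in> {1..N}" "p \<noteq> 0" "\<bar>p\<bar> * N < M"
  shows "x = y"
proof (rule ccontr)
  assume "x \<noteq> y"
  then have "\<bar>M\<bar> \<le> \<bar>p * (x - y)\<bar>" using assms by (intro dvd_imp_le_int) auto
  also have "\<dots> \<le> \<bar>p\<bar> * N" unfolding abs_mult using assms by (intro mult_left_mono) auto
  finally show False using assms by linarith
qed

text \<open>Every representation lifts to a quadruple in \<open>A\<close> itself, so popularity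
  among residues becomes a lower bound for the solution count in
  \<open>exists_nondegenerate_quadruple\<close>.\<close>

lemma card_representations_dilates_le:
  assumes "finite A"
  shows "card (representations M ((\<lambda>x. p * x mod int M) ` A) ((\<lambda>x. q * x mod int M) ` A) b)
    \<le> card {(x\<^sub>1, x\<^sub>2, x\<^sub>3, x\<^sub>4). x\<^sub>1 \<in> A \<and> x\<^sub>2 \<in> A \<and> x\<^sub>3 \<in> A \<and> x\<^sub>4 \<in> A \<and>
          int M dvd p * x\<^sub>1 - p * x\<^sub>2 + q * x\<^sub>3 - q * x\<^sub>4 - b}" (is "_ \<le> card ?S")
proof (rule surj_card_le)
  show "finite ?S"
    by (rule finite_subset[of _ "A \<times> A \<times> A \<times> A"]) (use assms in auto)
  let ?p = "\<lambda>x. p * x mod int M" and ?q = "\<lambda>x. q * x mod int M"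
  let ?f = "\<lambda>(x\<^sub>1, x\<^sub>2, x\<^sub>3, x\<^sub>4). (?p x\<^sub>1, ?p x\<^sub>2, ?q x\<^sub>3, ?q x\<^sub>4)"
  show "representations M (?p ` A) (?q ` A) b \<subseteq> ?f ` ?S"
  proof
    fix r assume "r \<in> representations M (?p ` A) (?q ` A) b"
    then obtain x\<^sub>1 x\<^sub>2 x\<^sub>3 x\<^sub>4 where x: "x\<^sub>1 \<in> A" "x\<^sub>2 \<in> A" "x\<^sub>3 \<in> A" "x\<^sub>4 \<in> A"
      and r: "r = ?f (x\<^sub>1, x\<^sub>2, x\<^sub>3, x\<^sub>4)" and b: "b = (?p x\<^sub>1 - ?p x\<^sub>2 + ?q x\<^sub>3 - ?q x\<^sub>4) mod int M"
      unfolding representations_def by auto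
    have "(?p x\<^sub>1 - ?p x\<^sub>2 + ?q x\<^sub>3 - ?q x\<^sub>4) mod int M = (p * x\<^sub>1 - p * x\<^sub>2 + q * x\<^sub>3 - q * x\<^sub>4) mod int M"
      by (intro mod_diff_cong mod_add_cong) simp_all
    then have "int M dvd p * x\<^sub>1 - p * x\<^sub>2 + q * x\<^sub>3 - q * x\<^sub>4 - b"
      using b by (simp add: mod_eq_dvd_iff[symmetric])
    with x have "(x\<^sub>1, x\<^sub>2, x\<^sub>3, x\<^sub>4) \<in> ?S" by simp
    with r show "r \<in> ?f ` ?S" by (rule image_eqI)
  qed
qed

section \<open>A solution in distinct elements from a Bohr set\<close>

text \<open>All asymptotics is isolated in two inequalities: \<open>rep\<close> beats the degenerate
  quadruples when at most \<open>k\<close> values are forbidden, and \<open>large\<close> leaves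
  \<open>k\<close> elements of \<open>A\<close> in a translate after the loss from shrinking the
  radii.\<close>

lemma has_distinct_solution_if_bohr_set:
  fixes k N s :: nat and a :: "nat \<Rightarrow> int"
  defines "M \<equiv> s * N + 1"
  assumes k: "k \<ge> 4" and nz: "a 1 \<noteq> 0" "a 3 \<noteq> 0" and inv: "invariant_equation k a"
    and a: "a 1 = - a 2" "a 3 = - a 4"
    and s: "(\<Sum>i=1..k. \<bar>a i\<bar>) = int s"
    and A: "A \<subseteq> {1..int N}"
    and \<Gamma>: "\<Gamma> \<subseteq> characters M" "finite \<Gamma>" and \<epsilon>: "\<And>\<gamma>. \<gamma> \<in> \<Gamma> \<Longrightarrow> 0 < \<epsilon> \<gamma>"
    and rep: "\<And>b. b \<in> bohr_set M \<Gamma> \<epsilon> \<Longrightarrow> (6 + 4 * k) * (card A)\<^sup>2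
      < card (representations M ((\<lambda>x. a 1 * x mod int M) ` A) ((\<lambda>x. a 3 * x mod int M) ` A) b)"
    and large: "k * M * (2 * (s + 1)) ^ card \<Gamma> \<le> card A * card (bohr_set M \<Gamma> \<epsilon>)"
  shows "has_distinct_solution k a A"
proof -
  let ?B' = "bohr_set M \<Gamma> (\<lambda>\<gamma>. \<epsilon> \<gamma> / real (s + 1))"
  have M: "M \<ge> 1" by (simp add: M_def)
  have finA: "finite A" using A finite_subset by blast
  have ivl: "{1..k} = insert 1 (insert 2 (insert 3 (insert 4 {5..k})))" using k by auto
  have split: "(\<Sum>i=1..k. f i) = f 1 + f 2 + f 3 + f 4 + (\<Sum>i=5..k. f i)" for f :: "nat \<Rightarrow> int"
    by (subst ivl) simp
  have "0 < \<bar>a 1\<bar>" using nz by simp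
  then have s1: "s \<ge> 1" using s unfolding split
    using sum_nonneg[of "{5..k}" "\<lambda>i. \<bar>a i\<bar>"] by linarith
  \<comment> \<open>Elements of \<open>A\<close> are thus their own residues modulo
    \<open>M\<close>.\<close>
  have NM: "N < M" using s1 by (cases s) (simp_all add: M_def)
  have "k * M * (2 * (s + 1)) ^ card \<Gamma> \<le> card A * ((2 * (s + 1)) ^ card \<Gamma> * card ?B')"
    using large card_bohr_set_le_shrunk[OF \<Gamma> M _ \<epsilon>, of "s + 1"]
    by (meson le_add2 mult_le_mono2 order_trans)
  then have kM: "k * M \<le> card A * card ?B'" by simp
  have "A \<subseteq> {0..<int M}" using A NM by auto
  moreover have "?B' \<subseteq> {0..<int M}" using M by (auto simp: bohr_set_def carrier_integer_mod_group)
  ultimately obtain t where t: "card A * card ?B' \<le> M * card {x \<in> A. (x - t) mod int M \<in> ?B'}"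
    using exists_translate_card_Int_ge[OF M] by blast
  define T where "T = {x \<in> A. (x - t) mod int M \<in> ?B'}"
  have "M * k \<le> M * card T" using order_trans[OF kM t] unfolding T_def by (simp only: mult.commute)
  then have "k \<le> card T" using M by simp
  then have "card {5..k} \<le> card T" by simp
  then obtain z where z: "z ` {5..k} \<subseteq> T" "inj_on z {5..k}"
    using card_le_inj[of "{5..k}" T] finA by (auto simp: T_def)
  let ?E = "z ` {5..k}"
  \<comment> \<open>The residue that the first four terms have to represent; it is 0 when
    \<open>k = 4\<close>, where the tail is empty.\<close>
  define b where "b = (- (\<Sum>i=5..k. a i * z i)) mod int M"
  \<comment> \<open>The first four coefficients cancel in pairs, so the tail is itself invariant and
    the shift \<open>t\<close> drops out below.\<close>
  have sum0: "(\<Sum>i=5..k. a i) = 0" using inv a unfolding invariant_equation_def split by simp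
  have small_coeffs: "(\<Sum>i=5..k. \<bar>- a i\<bar>) < int (s + 1)" using s unfolding split by simp
  have "(\<Sum>i=5..k. - a i * ((z i - t) mod int M)) mod int M \<in> bohr_set M \<Gamma> \<epsilon>"
  proof (rule bohr_set_weighted_sum[OF \<Gamma>(1) M finite_atLeastAtMost \<epsilon> small_coeffs])
    show "(z i - t) mod int M \<in> ?B'" if "i \<in> {5..k}" for i
      using z(1) that unfolding T_def by blast
  qed
  also have "(\<Sum>i=5..k. - a i * ((z i - t) mod int M)) mod int M
      = (\<Sum>i=5..k. - a i * (z i - t)) mod int M"
    by (subst (1 2) mod_sum_eq[symmetric]) (simp add: mod_mult_right_eq del: mult_minus_left)
  also have "(\<Sum>i=5..k. - a i * (z i - t)) = - (\<Sum>i=5..k. a i * z i) + t * (\<Sum>i=5..k. a i)"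
    by (simp add: algebra_simps sum_subtractf sum_distrib_left sum_negf)
  finally have "b \<in> bohr_set M \<Gamma> \<epsilon>" by (simp add: sum0 b_def)
  then have "(6 + 4 * k) * (card A)\<^sup>2
      < card (representations M ((\<lambda>x. a 1 * x mod int M) ` A) ((\<lambda>x. a 3 * x mod int M) ` A) b)"
    by (rule rep)
  also have "\<dots> \<le> card {(x\<^sub>1, x\<^sub>2, x\<^sub>3, x\<^sub>4). x\<^sub>1 \<in> A \<and> x\<^sub>2 \<in> A \<and> x\<^sub>3 \<in> A \<and> x\<^sub>4 \<in> A \<and>
          int M dvd a 1 * x\<^sub>1 - a 1 * x\<^sub>2 + a 3 * x\<^sub>3 - a 3 * x\<^sub>4 - b}"
    by (rule card_representations_dilates_le[OF finA])
  finally have *: "(6 + 4 * k) * (card A)\<^sup>2 < card {(x\<^sub>1, x\<^sub>2, x\<^sub>3, x\<^sub>4).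
      x\<^sub>1 \<in> A \<and> x\<^sub>2 \<in> A \<and> x\<^sub>3 \<in> A \<and> x\<^sub>4 \<in> A \<and>
          int M dvd a 1 * x\<^sub>1 - a 1 * x\<^sub>2 + a 3 * x\<^sub>3 - a 3 * x\<^sub>4 - b}" .
  have "card ?E \<le> k" using card_image_le[of "{5..k}" z] by simp
  then have "(6 + 4 * card ?E) * (card A)\<^sup>2 \<le> (6 + 4 * k) * (card A)\<^sup>2" by (intro mult_right_mono) auto
  note large' = le_less_trans[OF this *]
  have small: "\<bar>a i\<bar> * int N < int M" if "i \<in> {1..k}" for i
  proof -
    have "\<bar>a i\<bar> \<le> int s" unfolding s[symmetric] using that by (intro member_le_sum) auto
    then have "\<bar>a i\<bar> * int N \<le> int s * int N" by (intro mult_right_mono) auto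
    then show ?thesis by (simp add: M_def)
  qed
  \<comment> \<open>Forbidding the values in \<open>?E\<close> keeps the four new variables apart
    from those already chosen.\<close>
  obtain x\<^sub>1 x\<^sub>2 x\<^sub>3 x\<^sub>4 where x: "x\<^sub>1 \<in> A - ?E" "x\<^sub>2 \<in> A - ?E" "x\<^sub>3 \<in> A - ?E" "x\<^sub>4 \<in> A - ?E"
    "distinct [x\<^sub>1, x\<^sub>2, x\<^sub>3, x\<^sub>4]" "int M dvd a 1 * x\<^sub>1 - a 1 * x\<^sub>2 + a 3 * x\<^sub>3 - a 3 * x\<^sub>4 - b"
  proof (rule exists_nondegenerate_quadruple[OF finA _ _ _ large'])
    show "x = y" if "x \<in> A" "y \<in> A" "int M dvd a 1 * (x - y)" for x y
      using that A nz small[of 1] k by (intro dvd_mult_diff_imp_eq[of "int M" "a 1" x y "int N"]) auto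
    show "x = y" if "x \<in> A" "y \<in> A" "int M dvd a 3 * (x - y)" for x y
      using that A nz small[of 3] k by (intro dvd_mult_diff_imp_eq[of "int M" "a 3" x y "int N"]) auto
  qed auto
  define x where "x = z(1 := x\<^sub>1, 2 := x\<^sub>2, 3 := x\<^sub>3, 4 := x\<^sub>4)"
  have xz: "x i = z i" if "i \<in> {5..k}" for i using that by (auto simp: x_def)
  have x14: "x 1 = x\<^sub>1" "x 2 = x\<^sub>2" "x 3 = x\<^sub>3" "x 4 = x\<^sub>4" by (simp_all add: x_def)
  have imE: "x ` {5..k} = ?E" using xz by auto
  have xA: "x i \<in> A" if "i \<in> {1..k}" for i
  proof (cases "i \<in> {5..k}")
    case True
    then have "x i \<in> T" using z(1) xz by auto
    then show ?thesis by (simp add: T_def)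
  next
    case False
    then have "i = 1 \<or> i = 2 \<or> i = 3 \<or> i = 4" using that by auto
    then show ?thesis using x x14 by auto
  qed
  have inj: "inj_on x {1..k}"
    unfolding ivl using x z(2) inj_on_cong[of "{5..k}" x z] xz imE
    by (simp add: x14 x14(1)[unfolded One_nat_def])
  have sum: "(\<Sum>i=1..k. a i * x i) = a 1 * x\<^sub>1 - a 1 * x\<^sub>2 + a 3 * x\<^sub>3 - a 3 * x\<^sub>4 + (\<Sum>i=5..k. a i * z i)"
    using a xz unfolding split x14 by simp
  have "int M dvd - (\<Sum>i=5..k. a i * z i) - b"
    unfolding b_def by (simp add: mod_eq_dvd_iff[symmetric])
  then have "int M dvd (a 1 * x\<^sub>1 - a 1 * x\<^sub>2 + a 3 * x\<^sub>3 - a 3 * x\<^sub>4 - b) - (- (\<Sum>i=5..k. a i * z i) - b)"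
    by (rule dvd_diff[OF x(6)])
  then have dvd: "int M dvd (\<Sum>i=1..k. a i * x i)" unfolding sum by (simp add: algebra_simps)
  \<comment> \<open>The sum is at most \<open>s * N = M - 1\<close> in absolute value, so being
    divisible by \<open>M\<close> it is zero over the integers.\<close>
  have "\<bar>\<Sum>i=1..k. a i * x i\<bar> \<le> (\<Sum>i=1..k. \<bar>a i * x i\<bar>)" by (rule sum_abs)
  also have "\<dots> \<le> (\<Sum>i=1..k. \<bar>a i\<bar> * int N)"
  proof (rule sum_mono)
    fix i assume "i \<in> {1..k}"
    then have "\<bar>x i\<bar> \<le> int N" using xA A by fastforce
    then show "\<bar>a i * x i\<bar> \<le> \<bar>a i\<bar> * int N" by (simp add: abs_mult mult_left_mono)
  qed
  also have "\<dots> = int s * int N" unfolding s[symmetric] by (rule sum_distrib_right[symmetric])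
  finally have "\<bar>\<Sum>i=1..k. a i * x i\<bar> < \<bar>int M\<bar>" by (simp add: M_def)
  then have "(\<Sum>i=1..k. a i * x i) = 0" using dvd dvd_imp_le_int not_le by blast
  with xA inj show ?thesis unfolding has_distinct_solution_def by blast
qed

section \<open>Choice of the exponents and the final bound\<close>

theorem theorem23:
  fixes k :: nat and a :: "nat \<Rightarrow> int"
  assumes "bohr_hypothesis"
    and "k \<ge> 4"
    and "\<And>i. i \<in> {1..k} \<Longrightarrow> a i \<noteq> 0"
    and "invariant_equation k a"
    and "a 1 = - a 2" and "a 3 = - a 4"
  shows "\<exists>c>0. \<exists>C. \<forall>N\<ge>1. real (R k a N) \<le> C * real N powr (1 - c)"
proof -
  define s where "s = nat (\<Sum>i=1..k. \<bar>a i\<bar>)"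
  have s: "(\<Sum>i=1..k. \<bar>a i\<bar>) = int s" by (simp add: s_def sum_nonneg)
  \<comment> \<open>With this \<open>L\<close> the loss \<open>(2 * (s + 1)) ^ d\<close> equals 2 to
    the power \<open>L * d\<close>, hence is at most \<open>M\<close> to the power
    \<open>L * \<delta> c\<close>.\<close>
  define L where "L = log 2 (real (2 * (s + 1)))"
  have L: "L > 0" by (simp add: L_def)
  obtain \<delta> \<eta> :: "real \<Rightarrow> real"
    where lim: "(\<delta> \<longlongrightarrow> 0) (at_right 0)" "(\<eta> \<longlongrightarrow> 0) (at_right 0)"
      and hyp: "\<And>c. c > 0 \<Longrightarrow> \<exists>K\<^sub>1>0. \<exists>K\<^sub>2>0. \<forall>N\<ge>1. \<forall>A A'.
             A \<subseteq> carrier (integer_mod_group N) \<and> A' \<subseteq> carrier (integer_mod_group N) \<and>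
             real (card A) \<ge> real N powr (1 - c) \<and> real (card A') \<ge> real N powr (1 - c) \<longrightarrow>
             (\<exists>B d. is_bohr_set N d B \<and> real d \<le> \<delta> c * log 2 (real N) \<and>
                B \<subseteq> double_difference N A A' \<and>
                real (card B) \<ge> K\<^sub>1 * real N powr (1 - \<eta> c) \<and>
                (\<forall>b\<in>B. real (card (representations N A A' b))
                   \<ge> K\<^sub>2 * (real (card A))\<^sup>2 * (real (card A'))\<^sup>2 / real N))"
    using assms(1) unfolding bohr_hypothesis_def by auto
  \<comment> \<open>The budget: \<open>A\<close> and, up to \<open>K\<^sub>1\<close>,
    \<open>B\<close> have size at least \<open>M powr (7/8)\<close>, while shrinking the radii costs
    at most \<open>M powr (1/8)\<close>.\<close>
  have "\<forall>\<^sub>F c in at_right 0. c < 1/8 \<and> \<delta> c < 1 / (8 * L) \<and> \<eta> c < 1/8 \<and> (0::real) < c"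
    using L by (intro eventually_conj order_tendstoD(2)[OF lim(1)] order_tendstoD(2)[OF lim(2)]
        order_tendstoD(2)[OF tendsto_ident_at] eventually_at_right_less) auto
  then obtain c where c: "0 < c" "c < 1/8" "\<delta> c < 1 / (8 * L)" "\<eta> c < 1/8"
    using eventually_happens'[OF trivial_limit_at_right_real] by blast
  obtain K\<^sub>1 K\<^sub>2 where K: "K\<^sub>1 > 0" "K\<^sub>2 > 0" and bohr: "\<forall>N\<ge>1. \<forall>A A'.
       A \<subseteq> carrier (integer_mod_group N) \<and> A' \<subseteq> carrier (integer_mod_group N) \<and>
       real (card A) \<ge> real N powr (1 - c) \<and> real (card A') \<ge> real N powr (1 - c) \<longrightarrow>
       (\<exists>B d. is_bohr_set N d B \<and> real d \<le> \<delta> c * log 2 (real N) \<and>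
          B \<subseteq> double_difference N A A' \<and>
          real (card B) \<ge> K\<^sub>1 * real N powr (1 - \<eta> c) \<and>
          (\<forall>b\<in>B. real (card (representations N A A' b))
             \<ge> K\<^sub>2 * (real (card A))\<^sup>2 * (real (card A'))\<^sup>2 / real N))"
    using hyp[OF c(1)] by (elim exE conjE) (rule that)
  \<comment> \<open>The exponents are what the budget leaves: 5/8 = 7/8 + 7/8 - 1 - 1/8 for
    \<open>large\<close>, and 3/4 = 2 * 7/8 - 1 for \<open>rep\<close> after division by the square
    of \<open>card A\<close>.\<close>
  have "filterlim (\<lambda>M::nat. K\<^sub>1 * real M powr (5/8)) at_top at_top"
    "filterlim (\<lambda>M::nat. K\<^sub>2 * real M powr (3/4)) at_top at_top"
    using K by real_asymp+
  then have "\<forall>\<^sub>F M in at_top. real k < K\<^sub>1 * real M powr (5/8) \<and> 6 + 4 * real k < K\<^sub>2 * real M powr (3/4)"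
    unfolding filterlim_at_top_dense by (intro eventually_conj) blast+
  then obtain M\<^sub>0 where M\<^sub>0: "\<And>M. M \<ge> M\<^sub>0 \<Longrightarrow> real k < K\<^sub>1 * real M powr (5/8)"
      "\<And>M. M \<ge> M\<^sub>0 \<Longrightarrow> 6 + 4 * real k < K\<^sub>2 * real M powr (3/4)"
    unfolding eventually_sequentially by blast
  have a13: "a 1 \<noteq> 0" "a 3 \<noteq> 0" using assms(2,3) by auto
  have a1s: "\<bar>a i\<bar> \<le> int s" if "i \<in> {1..k}" for i
    unfolding s[symmetric] using that by (intro member_le_sum) auto
  have s1: "s \<ge> 1" using a1s[of 1] a13 assms(2) by simp
  \<comment> \<open>The factor \<open>s + 1\<close> compensates for the passage from
    \<open>N\<close> to \<open>M\<close>: since \<open>M \<le> (s + 1) * N\<close>, a set violating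
    the bound is dense enough modulo \<open>M\<close> for the hypothesis.\<close>
  have main: "real (card A) \<le> real (s + 1) * real N powr (1 - c)"
    if N: "N \<ge> 1" "N \<ge> M\<^sub>0" and A: "A \<subseteq> {1..int N}" and no: "\<not> has_distinct_solution k a A" for N A
  proof (rule ccontr)
    assume not_le: "\<not> ?thesis"
    define M where "M = s * N + 1"
    define m where "m = real M"
    have NM: "N \<le> M" using s1 by (cases s) (simp_all add: M_def)
    have M1: "M \<ge> 1" and m1: "m \<ge> 1" by (simp_all add: M_def m_def)
    have "m powr (1 - c) \<le> (real (s + 1) * real N) powr (1 - c)"
      using N c by (intro powr_mono2) (simp_all add: m_def M_def algebra_simps)
    also have "\<dots> = real (s + 1) powr (1 - c) * real N powr (1 - c)"
      by (subst powr_mult) auto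
    also have "\<dots> \<le> real (s + 1) powr 1 * real N powr (1 - c)"
      using c by (intro mult_right_mono powr_mono) auto
    finally have cA: "m powr (1 - c) \<le> real (card A)" using not_le by simp
    have "m powr (7/8) \<le> m powr (1 - c)" using c m1 by (intro powr_mono) auto
    with cA have cA': "m powr (7/8) \<le> real (card A)" by simp
    have inj: "inj_on (\<lambda>x. a i * x mod int M) A" if "i \<in> {1..k}" for i
    proof (rule inj_onI)
      fix x y assume xy: "x \<in> A" "y \<in> A" "a i * x mod int M = a i * y mod int M"
      have "\<bar>a i\<bar> * int N \<le> int s * int N" using a1s[OF that] by (intro mult_right_mono) auto
      then show "x = y" using xy A assms(3)[OF that]
        by (intro dvd_mult_diff_imp_eq[of "int M" "a i" x y "int N"])
          (auto simp: M_def mod_eq_dvd_iff right_diff_distrib)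
    qed
    let ?A1 = "(\<lambda>x. a 1 * x mod int M) ` A" and ?A3 = "(\<lambda>x. a 3 * x mod int M) ` A"
    have card1: "card ?A1 = card A" and card3: "card ?A3 = card A"
      using inj assms(2) by (auto intro!: card_image)
    have dilates: "?A1 \<subseteq> carrier (integer_mod_group M)" "?A3 \<subseteq> carrier (integer_mod_group M)"
      "real (card ?A1) \<ge> real M powr (1 - c)" "real (card ?A3) \<ge> real M powr (1 - c)"
      using M1 cA unfolding card1 card3 m_def by (auto simp: carrier_integer_mod_group)
    obtain B d where B: "is_bohr_set M d B"
      and d: "real d \<le> \<delta> c * log 2 m"
      and cB: "real (card B) \<ge> K\<^sub>1 * m powr (1 - \<eta> c)"
      and rep: "\<forall>b\<in>B. real (card (representations M ?A1 ?A3 b))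
          \<ge> K\<^sub>2 * (real (card A))\<^sup>2 * (real (card A))\<^sup>2 / m"
      using bohr[rule_format, OF M1 conjI[OF dilates(1) conjI[OF dilates(2) conjI[OF dilates(3,4)]]]]
      unfolding card1 card3 m_def by (elim exE conjE) (rule that[unfolded m_def])
    obtain \<Gamma> \<epsilon> where \<Gamma>: "\<Gamma> \<subseteq> characters M" "finite \<Gamma>" "card \<Gamma> = d"
      and \<epsilon>: "\<And>\<gamma>. \<gamma> \<in> \<Gamma> \<Longrightarrow> 0 < \<epsilon> \<gamma>" and Beq: "B = bohr_set M \<Gamma> \<epsilon>"
      using B unfolding is_bohr_set_def by blast
    have "has_distinct_solution k a A"
    proof (rule has_distinct_solution_if_bohr_set[OF assms(2) a13 assms(4-6) s A, folded M_def, OF \<Gamma>(1,2) \<epsilon>])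
      fix b assume "b \<in> bohr_set M \<Gamma> \<epsilon>"
      then have r: "real (card (representations M ?A1 ?A3 b))
          \<ge> K\<^sub>2 * (real (card A))\<^sup>2 * (real (card A))\<^sup>2 / m"
        using rep Beq by blast
      have pos: "0 < real (card A)" using cA' m1 by (smt (verit) powr_gt_zero)
      \<comment> \<open>About \<open>(card A)\<^sup>4 / m\<close> representations must exceed a
        multiple of \<open>(card A)\<^sup>2\<close>, so the square of \<open>card A\<close> is
        compared with \<open>m\<close>.\<close>
      have "(6 + 4 * real k) * m < K\<^sub>2 * m powr (3/4) * m"
        using M\<^sub>0(2)[of M] N NM m1 by (intro mult_strict_right_mono) (auto simp: m_def)
      also have "\<dots> = K\<^sub>2 * (m powr (7/8))\<^sup>2"
        using m1 by (simp add: power2_eq_square flip: powr_add) (simp add: powr_mult_base mult.commute)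
      also have "\<dots> \<le> K\<^sub>2 * (real (card A))\<^sup>2"
        using cA' K by (intro mult_left_mono power_mono) auto
      finally have "6 + 4 * real k < K\<^sub>2 * (real (card A))\<^sup>2 / m" using m1 by (simp add: field_simps)
      then have "(6 + 4 * real k) * (real (card A))\<^sup>2 < K\<^sub>2 * (real (card A))\<^sup>2 / m * (real (card A))\<^sup>2"
        using pos by (intro mult_strict_right_mono) auto
      also have "\<dots> \<le> real (card (representations M ?A1 ?A3 b))" using r by (simp add: mult_ac)
      finally have "real ((6 + 4 * k) * (card A)\<^sup>2) < real (card (representations M ?A1 ?A3 b))" by simp
      then show "(6 + 4 * k) * (card A)\<^sup>2 < card (representations M ?A1 ?A3 b)"
        unfolding of_nat_less_iff .
    next
      have "real ((2 * (s + 1)) ^ d) = 2 powr (L * real d)"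
        by (simp add: L_def powr_powr[symmetric] powr_realpow)
      also have "\<dots> \<le> 2 powr (1/8 * log 2 m)"
      proof (rule powr_mono)
        have "L * real d \<le> L * (\<delta> c * log 2 m)" using d L by (intro mult_left_mono) auto
        also have "\<dots> = (L * \<delta> c) * log 2 m" by simp
        also have "\<dots> \<le> 1/8 * log 2 m"
          using c L m1 by (intro mult_right_mono) (auto simp: field_simps)
        finally show "L * real d \<le> 1/8 * log 2 m" .
      qed simp
      also have "\<dots> = m powr (1/8)"
        using m1 by (simp add: powr_def log_def field_simps)
      finally have p: "real ((2 * (s + 1)) ^ d) \<le> m powr (1/8)" .
      have "m powr (7/8) \<le> m powr (1 - \<eta> c)" using c m1 by (intro powr_mono) auto
      then have cB': "K\<^sub>1 * m powr (7/8) \<le> real (card B)"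
        using cB K by (smt (verit) mult_left_mono)
      have "real (k * M * (2 * (s + 1)) ^ d) = real k * m * real ((2 * (s + 1)) ^ d)"
        by (simp add: m_def)
      also have "\<dots> \<le> (K\<^sub>1 * m powr (5/8)) * m * m powr (1/8)"
        using M\<^sub>0(1)[of M] N NM m1 p K by (intro mult_mono) (auto simp: m_def)
      also have "\<dots> = K\<^sub>1 * (m powr (5/8) * m powr 1 * m powr (1/8))" using m1 by simp
      also have "\<dots> = K\<^sub>1 * (m powr (7/8) * m powr (7/8))" unfolding powr_add[symmetric] by simp
      also have "\<dots> = m powr (7/8) * (K\<^sub>1 * m powr (7/8))" by simp
      also have "\<dots> \<le> real (card A) * real (card B)"
        using cA' cB' K by (intro mult_mono) auto
      finally have "real (k * M * (2 * (s + 1)) ^ d) \<le> real (card A * card B)" by simp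
      then show "k * M * (2 * (s + 1)) ^ card \<Gamma> \<le> card A * card (bohr_set M \<Gamma> \<epsilon>)"
        unfolding of_nat_le_iff \<Gamma>(3) Beq .
    qed
    with no show False by contradiction
  qed
  show ?thesis
  proof (intro exI conjI allI impI)
    show "c > 0" by (rule c)
    fix N :: nat assume N: "N \<ge> 1"
    let ?F = "{A. A \<subseteq> {1..int N} \<and> \<not> has_distinct_solution k a A}"
    have "finite ?F" by (rule finite_subset[of _ "Pow {1..int N}"]) auto
    \<comment> \<open>The empty set qualifies because there is at least one variable; hence the
      maximum in \<open>R\<close> is attained.\<close>
    moreover have "{} \<in> ?F" using assms(2) by (auto simp: has_distinct_solution_def)
    ultimately have "R k a N \<in> card ` ?F" unfolding R_def by (intro Max_in) auto
    then obtain A where A: "A \<subseteq> {1..int N}" "\<not> has_distinct_solution k a A" "R k a N = card A"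
      by auto
    have pos: "1 \<le> real N powr (1 - c)" using N c by (intro ge_one_powr_ge_zero) auto
    \<comment> \<open>The summand \<open>M\<^sub>0\<close> covers the finitely many \<open>N\<close>
      below the threshold, where \<open>card A \<le> N\<close> suffices.\<close>
    show "real (R k a N) \<le> real (s + 1 + M\<^sub>0) * real N powr (1 - c)"
    proof (cases "N \<ge> M\<^sub>0")
      case True
      have "real (card A) \<le> real (s + 1) * real N powr (1 - c)" by (rule main[OF N True A(1,2)])
      also have "\<dots> \<le> real (s + 1 + M\<^sub>0) * real N powr (1 - c)" by (intro mult_right_mono) auto
      finally show ?thesis using A by simp
    next
      case False
      have "card A \<le> N" using card_mono[OF _ A(1)] by simp
      then have "real (card A) \<le> real (s + 1 + M\<^sub>0) * 1" using False by simp
      also have "\<dots> \<le> real (s + 1 + M\<^sub>0) * real N powr (1 - c)"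
        using pos by (intro mult_left_mono) auto
      finally show ?thesis using A by simp
    qed
  qed
qed

end
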